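(* Assume $Q\ge 0$, $Q+\bar Q\ge 0$, $G\ge 0$, $G+\bar G\ge 0$, $R>0$, $R+\bar R>0$. Let $\Pi(\cdot)$ be the solution of the differential Riccati equation $$\Pi'+\Pi\hat A+\hat A^\top\Pi+\hat C^\top P\hat C+\hat Q-(\hat B^\top\Pi+\hat D^\top P\hat C)^\top\Sigma_1^{-1}(\hat B^\top\Pi+\hat D^\top P\hat C)=0\ \text{ on }[0,T],\quad \Pi(T)=\hat G,$$ and, for each $N$ with $\tau=T/N\le1$, let $(\Pi_k)_{k=0}^N$ be the solution of the difference Riccati equation: $\Pi_N=\hat G$ and, for $k=N-1,\dots,0$, $$\Pi_k=(I_n+\tau\tilde A_k)^\top\Pi_{k+1}(I_n+\tau\tilde A_k)+\tau\tilde Q_k-\tau H_k^\top W_k^{-1}H_k,\quad H_k=\tilde B_k^\top\Pi_{k+1}(I_n+\tau\tilde A_k),\quad W_k=\tilde R_k+\tau\tilde B_k^\top\Pi_{k+1}\tilde B_k .$$ Then there exists a constant $\mathcal C>0$ independent of $\tau$ such that $$\max_{l=0,1,\dots,N}\|\Pi(t_l)-\Pi_l\|\le\mathcal C\,\tau .$$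
   Context: Fix $T>0$, integers $n,m\ge1$, and constant matrices $A,\bar A,C,\bar C,Q,\bar Q,G,\bar G\in\mathbb R^{n\times n}$, $B,\bar B,D,\bar D\in\mathbb R^{n\times m}$, $R,\bar R\in\mathbb R^{m\times m}$, with $Q,\bar Q,G,\bar G,R,\bar R$ symmetric; $M\ge0$ ($M>0$) means symmetric positive semi-definite (definite). Write $\hat\varphi=\varphi+\bar\varphi$ for $\varphi=A,B,C,D,Q,R,G$. $\|M\|$ is the spectral norm of a matrix. $P(\cdot)$ is the unique (positive semi-definite) solution on $[0,T]$ of $$P'+PA+A^\top P+C^\top PC+Q-(B^\top P+D^\top PC)^\top(R+D^\top PD)^{-1}(B^\top P+D^\top PC)=0,\quad P(T)=G,$$ and $\Sigma_1=\hat R+\hat D^\top P\hat D$. Under the stated assumptions the equation for $\Pi$ is known to have a unique, positive semi-definite solution on $[0,T]$. Mesh: $N\in\mathbb N$, $\tau=T/N\le1$, $t_k=k\tau$. $(P_k)_{k=0}^N$ is given by $P_N=G$ and for $k=N-1,\dots,0$ $$P_k=\tau Q+(I_n+\tau A)^\top P_{k+1}(I_n+\tau A)+\tau C^\top P_{k+1}C-\tau (H^1_k)^\top (W^1_k)^{-1}H^1_k,$$ $$W^1_k=R+\tau B^\top P_{k+1}B+D^\top P_{k+1}D,\qquad H^1_k=B^\top P_{k+1}(I_n+\tau A)+D^\top P_{k+1}C.$$ Further $$\tilde R_k=\hat R+\hat D^\top P_k\hat D,\quad \tilde Q_k=\hat Q+\hat C^\top P_k\hat C-\hat C^\top P_k\hat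 D\tilde R_k^{-1}\hat D^\top P_k\hat C,\quad \tilde A_k=\hat A-\hat B\tilde R_k^{-1}\hat D^\top P_k\hat C,\quad \tilde B_k=\hat B.$$ The constant $\mathcal C$ may depend on $T$ and the coefficient matrices. *)

theory Defs
  imports "HOL-Analysis.Analysis"
begin

definition psd :: "real ^ 'n ^ 'n \<Rightarrow> bool" where
  "psd M \<longleftrightarrow> transpose M = M \<and> (\<forall>x. 0 \<le> x \<bullet> (M *v x))"

definition pd :: "real ^ 'n ^ 'n \<Rightarrow> bool" where
  "pd M \<longleftrightarrow> transpose M = M \<and> (\<forall>x. x \<noteq> 0 \<longrightarrow> 0 < x \<bullet> (M *v x))"

(* matrix_inv is unspecified on singular matrices. Under the positivity assumptions on the
   coefficients, every matrix inverted below is positive definite along the solution. *)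

(* Derivatives are taken within {0..T}, hence are one-sided at the end points. *)

definition riccati_P ::
  "real \<Rightarrow> real ^ 'n ^ 'n \<Rightarrow> real ^ 'm ^ 'n \<Rightarrow> real ^ 'n ^ 'n \<Rightarrow> real ^ 'm ^ 'n \<Rightarrow>
   real ^ 'n ^ 'n \<Rightarrow> real ^ 'm ^ 'm \<Rightarrow> real ^ 'n ^ 'n \<Rightarrow> (real \<Rightarrow> real ^ 'n ^ 'n) \<Rightarrow> bool" where
  "riccati_P T A B C D Q R G P \<longleftrightarrow>
     P T = G \<and>
     (\<forall>t\<in>{0..T}. psd (P t)) \<and>
     (\<forall>t\<in>{0..T}. \<exists>P'. (P has_vector_derivative P') (at t within {0..T}) \<and>
        (let H = transpose B ** P t + transpose D ** P t ** C;
             S = R + transpose D ** P t ** D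
         in P' + P t ** A + transpose A ** P t + transpose C ** P t ** C + Q
            - transpose H ** matrix_inv S ** H = 0))"

(* The coefficient arguments of riccati_Pi and difference_riccati_Pi are the hatted matrices,
   e.g. A stands for the sum of A and A-bar. *)

definition riccati_Pi ::
  "real \<Rightarrow> real ^ 'n ^ 'n \<Rightarrow> real ^ 'm ^ 'n \<Rightarrow> real ^ 'n ^ 'n \<Rightarrow> real ^ 'm ^ 'n \<Rightarrow>
   real ^ 'n ^ 'n \<Rightarrow> real ^ 'm ^ 'm \<Rightarrow> real ^ 'n ^ 'n \<Rightarrow>
   (real \<Rightarrow> real ^ 'n ^ 'n) \<Rightarrow> (real \<Rightarrow> real ^ 'n ^ 'n) \<Rightarrow> bool" where
  "riccati_Pi T A B C D Q R G P \<Pi>\<^sub>c \<longleftrightarrow>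
     \<Pi>\<^sub>c T = G \<and>
     (\<forall>t\<in>{0..T}. \<exists>\<Pi>\<^sub>c'. (\<Pi>\<^sub>c has_vector_derivative \<Pi>\<^sub>c') (at t within {0..T}) \<and>
        (let H = transpose B ** \<Pi>\<^sub>c t + transpose D ** P t ** C;
             \<Sigma>\<^sub>1 = R + transpose D ** P t ** D
         in \<Pi>\<^sub>c' + \<Pi>\<^sub>c t ** A + transpose A ** \<Pi>\<^sub>c t + transpose C ** P t ** C + Q
            - transpose H ** matrix_inv \<Sigma>\<^sub>1 ** H = 0))"

definition difference_riccati_P ::
  "real \<Rightarrow> nat \<Rightarrow> real ^ 'n ^ 'n \<Rightarrow> real ^ 'm ^ 'n \<Rightarrow> real ^ 'n ^ 'n \<Rightarrow> real ^ 'm ^ 'n \<Rightarrow>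
   real ^ 'n ^ 'n \<Rightarrow> real ^ 'm ^ 'm \<Rightarrow> real ^ 'n ^ 'n \<Rightarrow> (nat \<Rightarrow> real ^ 'n ^ 'n) \<Rightarrow> bool" where
  "difference_riccati_P \<tau> N A B C D Q R G p \<longleftrightarrow>
     p N = G \<and>
     (\<forall>k<N.
        let X = p (Suc k);
            E = mat 1 + \<tau> *\<^sub>R A;
            W = R + \<tau> *\<^sub>R (transpose B ** X ** B) + transpose D ** X ** D;
            H = transpose B ** X ** E + transpose D ** X ** C
        in p k = \<tau> *\<^sub>R Q + transpose E ** X ** E + \<tau> *\<^sub>R (transpose C ** X ** C)
                 - \<tau> *\<^sub>R (transpose H ** matrix_inv W ** H))"

definition difference_riccati_Pi ::
  "real \<Rightarrow> nat \<Rightarrow> real ^ 'n ^ 'n \<Rightarrow> real ^ 'm ^ 'n \<Rightarrow> real ^ 'n ^ 'n \<Rightarrow> real ^ 'm ^ 'n \<Rightarrow>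
   real ^ 'n ^ 'n \<Rightarrow> real ^ 'm ^ 'm \<Rightarrow> real ^ 'n ^ 'n \<Rightarrow>
   (nat \<Rightarrow> real ^ 'n ^ 'n) \<Rightarrow> (nat \<Rightarrow> real ^ 'n ^ 'n) \<Rightarrow> bool" where
  "difference_riccati_Pi \<tau> N A B C D Q R G p \<pi> \<longleftrightarrow>
     \<pi> N = G \<and>
     (\<forall>k<N.
        let Rt = R + transpose D ** p k ** D;
            Qt = Q + transpose C ** p k ** C
                 - transpose C ** p k ** D ** matrix_inv Rt ** transpose D ** p k ** C;
            At = A - B ** matrix_inv Rt ** transpose D ** p k ** C;
            Bt = B;
            X = \<pi> (Suc k);
            E = mat 1 + \<tau> *\<^sub>R At;
            H = transpose Bt ** X ** E;
            W = Rt + \<tau> *\<^sub>R (transpose Bt ** X ** Bt)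
        in \<pi> k = transpose E ** X ** E + \<tau> *\<^sub>R Qt
                 - \<tau> *\<^sub>R (transpose H ** matrix_inv W ** H))"

end

theory Submission
  imports Defs
begin

text \<open>
  The pair \<open>(P, \<Pi>)\<close> solves one backward equation \<open>x' = - F (0, x)\<close>, and the pair of difference
  equations is its one-step scheme \<open>z\<^sub>k = z\<^sub>k\<^sub>+\<^sub>1 + \<tau> F (\<tau>, z\<^sub>k\<^sub>+\<^sub>1)\<close>, where \<open>F\<close> is built
  from products and inverses of matrices. Along the compact curve \<open>(0, x t)\<close> the inverted matrices
  are uniformly coercive, so \<open>F\<close> is Lipschitz from points of the curve to nearby points, also in
  \<open>\<tau>\<close>. Comparing \<open>F (\<tau>, z\<^sub>k\<^sub>+\<^sub>1)\<close> directly with \<open>F (0, x s)\<close> on each mesh interval yields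
  \<open>e\<^sub>k \<le> (1 + L \<tau>) e\<^sub>k\<^sub>+\<^sub>1 + L (1 + L) \<tau>\<^sup>2\<close> as long as the scheme stays in the tube, which it does
  for small \<open>\<tau>\<close>. The finitely many coarse meshes need no a priori bound on the scheme, because each
  admits at most one discrete solution.
\<close>

section \<open>Calm functions: Lipschitz estimates from a set to its neighbourhood\<close>

text \<open>One of the two points is held in \<open>K\<close>, the other is any point close to it:
  the exact solution stays on the curve, while the scheme only comes near it. Positivity then has to
  be known on the curve alone. The same \<open>L\<close> bounds the values on \<open>K\<close>, as
  products of such functions require.\<close>

definition calm_on :: "'a::real_normed_vector set \<Rightarrow> ('a \<Rightarrow> 'b::real_normed_vector) \<Rightarrow> bool" where
  "calm_on K f \<longleftrightarrow> (\<exists>\<rho>>0. \<exists>L\<ge>0. \<forall>u\<in>K. norm (f u) \<le> L \<and>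
     (\<forall>v. norm (v - u) \<le> \<rho> \<longrightarrow> norm (f v - f u) \<le> L * norm (v - u)))"

lemma calm_onI:
  assumes "0 < \<rho>" "0 \<le> L"
    and "\<And>u. u \<in> K \<Longrightarrow> norm (f u) \<le> L"
    and "\<And>u v. u \<in> K \<Longrightarrow> norm (v - u) \<le> \<rho> \<Longrightarrow> norm (f v - f u) \<le> L * norm (v - u)"
  shows "calm_on K f"
  unfolding calm_on_def using assms by blast

lemma calm_onE:
  assumes "calm_on K f"
  obtains \<rho> L where "0 < \<rho>" "0 \<le> L"
    "\<And>u. u \<in> K \<Longrightarrow> norm (f u) \<le> L"
    "\<And>u v. u \<in> K \<Longrightarrow> norm (v - u) \<le> \<rho> \<Longrightarrow> norm (f v - f u) \<le> L * norm (v - u)"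
  using assms unfolding calm_on_def by blast

lemma calm_on_const: "calm_on K (\<lambda>_. c)"
  by (rule calm_onI[of 1 "norm c"]) auto

lemma calm_on_ident:
  assumes "bounded K"
  shows "calm_on K (\<lambda>u. u)"
proof -
  obtain b where b: "b > 0" "\<And>u. u \<in> K \<Longrightarrow> norm u \<le> b"
    using assms bounded_pos by blast
  show ?thesis
  proof (rule calm_onI[of 1 "b + 1"])
    fix u v :: 'a
    have "1 * norm (v - u) \<le> (b + 1) * norm (v - u)"
      using b by (intro mult_right_mono) auto
    then show "norm (v - u) \<le> (b + 1) * norm (v - u)" by simp
  qed (use b in force)+
qed

lemma calm_onE2:
  assumes "calm_on K f" "calm_on K g"
  obtains \<rho> L where "0 < \<rho>" "0 \<le> L"
    "\<And>u. u \<in> K \<Longrightarrow> norm (f u) \<le> L" "\<And>u. u \<in> K \<Longrightarrow> norm (g u) \<le> L"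
    "\<And>u v. u \<in> K \<Longrightarrow> norm (v - u) \<le> \<rho> \<Longrightarrow> norm (f v - f u) \<le> L * norm (v - u)"
    "\<And>u v. u \<in> K \<Longrightarrow> norm (v - u) \<le> \<rho> \<Longrightarrow> norm (g v - g u) \<le> L * norm (v - u)"
proof -
  obtain r1 L1 where 1: "0 < r1" "0 \<le> L1" "\<And>u. u \<in> K \<Longrightarrow> norm (f u) \<le> L1"
    "\<And>u v. u \<in> K \<Longrightarrow> norm (v - u) \<le> r1 \<Longrightarrow> norm (f v - f u) \<le> L1 * norm (v - u)"
    using calm_onE[OF assms(1)] by blast
  obtain r2 L2 where 2: "0 < r2" "0 \<le> L2" "\<And>u. u \<in> K \<Longrightarrow> norm (g u) \<le> L2"
    "\<And>u v. u \<in> K \<Longrightarrow> norm (v - u) \<le> r2 \<Longrightarrow> norm (g v - g u) \<le> L2 * norm (v - u)"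
    using calm_onE[OF assms(2)] by blast
  have m: "L1 * d \<le> max L1 L2 * d" "L2 * d \<le> max L1 L2 * d" if "0 \<le> d" for d
    using that by (auto intro: mult_right_mono)
  show ?thesis
  proof (rule that[of "min r1 r2" "max L1 L2"])
    fix u v assume u: "u \<in> K" and v: "norm (v - u) \<le> min r1 r2"
    show "norm (f v - f u) \<le> max L1 L2 * norm (v - u)"
      using 1(4)[OF u, of v] v m(1)[of "norm (v - u)"] by simp
    show "norm (g v - g u) \<le> max L1 L2 * norm (v - u)"
      using 2(4)[OF u, of v] v m(2)[of "norm (v - u)"] by simp
  qed (use 1 2 in \<open>auto simp: le_max_iff_disj\<close>)
qed

text \<open>The factors are varied one at a time. The value \<open>f v\<close> may be taken off
  \<open>K\<close>, so its bound is the one at \<open>u\<close> plus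
  \<open>L * \<rho>\<close>.\<close>

lemma calm_on_bilinear:
  assumes "bounded_bilinear h" "calm_on K f" "calm_on K g"
  shows "calm_on K (\<lambda>u. h (f u) (g u))"
proof -
  interpret bounded_bilinear h by fact
  obtain c where c: "0 \<le> c" "\<And>a b. norm (h a b) \<le> norm a * norm b * c"
    using nonneg_bounded by blast
  obtain \<rho> L where L: "0 < \<rho>" "0 \<le> L"
    "\<And>u. u \<in> K \<Longrightarrow> norm (f u) \<le> L" "\<And>u. u \<in> K \<Longrightarrow> norm (g u) \<le> L"
    "\<And>u v. u \<in> K \<Longrightarrow> norm (v - u) \<le> \<rho> \<Longrightarrow> norm (f v - f u) \<le> L * norm (v - u)"
    "\<And>u v. u \<in> K \<Longrightarrow> norm (v - u) \<le> \<rho> \<Longrightarrow> norm (g v - g u) \<le> L * norm (v - u)"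
    using calm_onE2[OF assms(2,3)] by blast
  \<comment> \<open>The first two summands come from the change of \<open>g\<close> weighted by
    \<open>f v\<close>, the last from the change of \<open>f\<close> weighted by \<open>g u\<close>.
    A single \<open>L * L * c\<close> already bounds the values.\<close>
  let ?M = "L * L * c + L * L * c * \<rho> + L * L * c"
  show ?thesis
  proof (rule calm_onI[of \<rho> ?M])
    show "0 \<le> ?M" using L c by simp
    fix u assume u: "u \<in> K"
    have "norm (h (f u) (g u)) \<le> norm (f u) * norm (g u) * c" by (rule c)
    also have "\<dots> \<le> L * L * c"
      using L(2) L(3,4)[OF u] c(1) by (intro mult_mono mult_right_mono) auto
    also have "\<dots> \<le> ?M" using L c by simp
    finally show "norm (h (f u) (g u)) \<le> ?M" .
    fix v assume v: "norm (v - u) \<le> \<rho>"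
    let ?d = "norm (v - u)"
    have df: "norm (f v - f u) \<le> L * ?d" and dg: "norm (g v - g u) \<le> L * ?d"
      using L(5,6)[OF u v] by auto
    have "norm (f v) \<le> norm (f u) + norm (f v - f u)"
      by (metis norm_triangle_sub)
    also have "\<dots> \<le> L + L * \<rho>"
      using df L(3)[OF u] mult_left_mono[OF v L(2)] by linarith
    finally have fv: "norm (f v) \<le> L + L * \<rho>" .
    have "h (f v) (g v) - h (f u) (g u) = h (f v) (g v - g u) + h (f v - f u) (g u)"
      by (simp add: diff_left diff_right)
    then have "norm (h (f v) (g v) - h (f u) (g u))
        \<le> norm (h (f v) (g v - g u)) + norm (h (f v - f u) (g u))"
      by (metis norm_triangle_ineq)
    also have "\<dots> \<le> norm (f v) * norm (g v - g u) * c + norm (f v - f u) * norm (g u) * c"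
      by (intro add_mono c)
    also have "\<dots> \<le> (L + L * \<rho>) * (L * ?d) * c + (L * ?d) * L * c"
      using L(1,2) L(4)[OF u] c(1) fv df dg by (intro add_mono mult_right_mono mult_mono) auto
    also have "\<dots> = ?M * ?d" by (simp add: algebra_simps)
    finally show "norm (h (f v) (g v) - h (f u) (g u)) \<le> ?M * ?d" .
  qed (use L in auto)
qed

lemma calm_on_linear:
  assumes "bounded_linear h" "calm_on K f"
  shows "calm_on K (\<lambda>u. h (f u))"
proof -
  interpret bounded_linear h by fact
  obtain c where c: "0 \<le> c" "\<And>a. norm (h a) \<le> norm a * c"
    using nonneg_bounded by blast
  obtain \<rho> L where L: "0 < \<rho>" "0 \<le> L" "\<And>u. u \<in> K \<Longrightarrow> norm (f u) \<le> L"
    "\<And>u v. u \<in> K \<Longrightarrow> norm (v - u) \<le> \<rho> \<Longrightarrow> norm (f v - f u) \<le> L * norm (v - u)"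
    using calm_onE[OF assms(2)] by blast
  show ?thesis
  proof (rule calm_onI[of \<rho> "L * c"])
    fix u assume u: "u \<in> K"
    show "norm (h (f u)) \<le> L * c"
      using c(2)[of "f u"] mult_right_mono[OF L(3)[OF u] c(1)] by linarith
    fix v assume v: "norm (v - u) \<le> \<rho>"
    show "norm (h (f v) - h (f u)) \<le> L * c * norm (v - u)"
      using c(2)[of "f v - f u"] mult_right_mono[OF L(4)[OF u v] c(1)]
      by (simp add: diff algebra_simps)
  qed (use L c in auto)
qed

lemma calm_on_Pair:
  assumes "calm_on K f" "calm_on K g"
  shows "calm_on K (\<lambda>u. (f u, g u))"
proof -
  obtain \<rho> L where L: "0 < \<rho>" "0 \<le> L"
    "\<And>u. u \<in> K \<Longrightarrow> norm (f u) \<le> L" "\<And>u. u \<in> K \<Longrightarrow> norm (g u) \<le> L"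
    "\<And>u v. u \<in> K \<Longrightarrow> norm (v - u) \<le> \<rho> \<Longrightarrow> norm (f v - f u) \<le> L * norm (v - u)"
    "\<And>u v. u \<in> K \<Longrightarrow> norm (v - u) \<le> \<rho> \<Longrightarrow> norm (g v - g u) \<le> L * norm (v - u)"
    using calm_onE2[OF assms] by blast
  show ?thesis
  proof (rule calm_onI[of \<rho> "2 * L"])
    fix u assume u: "u \<in> K"
    show "norm (f u, g u) \<le> 2 * L"
      using norm_Pair_le[of "f u" "g u"] L(3,4)[OF u] by linarith
    fix v assume v: "norm (v - u) \<le> \<rho>"
    show "norm ((f v, g v) - (f u, g u)) \<le> 2 * L * norm (v - u)"
      using norm_Pair_le[of "f v - f u" "g v - g u"] L(5,6)[OF u v] by simp
  qed (use L in auto)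
qed

lemma calm_on_add:
  assumes "calm_on K f" "calm_on K g"
  shows "calm_on K (\<lambda>u. f u + g u)"
  using calm_on_linear[OF bounded_linear_add[OF bounded_linear_fst bounded_linear_snd]
      calm_on_Pair[OF assms]] by simp

lemma calm_on_diff:
  assumes "calm_on K f" "calm_on K g"
  shows "calm_on K (\<lambda>u. f u - g u)"
  using calm_on_linear[OF bounded_linear_sub[OF bounded_linear_fst bounded_linear_snd]
      calm_on_Pair[OF assms]] by simp

section \<open>Matrix products, norms and inverses of coercive matrices\<close>

lemma bounded_bilinear_matrix_mult:
  "bounded_bilinear ((**) :: real ^ 'n ^ 'm \<Rightarrow> real ^ 'p ^ 'n \<Rightarrow> real ^ 'p ^ 'm)"
  unfolding bilinear_conv_bounded_bilinear[symmetric] bilinear_def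
  by (auto intro!: linearI simp: matrix_add_ldistrib matrix_scalar_ac scalar_matrix_assoc
      matrix_matrix_mult_def vec_eq_iff sum.distrib sum_distrib_left algebra_simps)

lemma bounded_linear_transpose:
  "bounded_linear (transpose :: real ^ 'n ^ 'm \<Rightarrow> real ^ 'm ^ 'n)"
  unfolding linear_conv_bounded_linear[symmetric]
  by (rule linearI) (auto simp: transpose_def vec_eq_iff)

text \<open>Rewriting with these expands a matrix expression into a sum of left-associated
  monomials, which can be compared termwise.\<close>

lemmas matrix_mult_simps =
  bounded_bilinear.add_left[OF bounded_bilinear_matrix_mult]
  bounded_bilinear.add_right[OF bounded_bilinear_matrix_mult]
  bounded_bilinear.diff_left[OF bounded_bilinear_matrix_mult]
  bounded_bilinear.diff_right[OF bounded_bilinear_matrix_mult]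
  bounded_bilinear.minus_left[OF bounded_bilinear_matrix_mult]
  bounded_bilinear.minus_right[OF bounded_bilinear_matrix_mult]
  bounded_bilinear.zero_left[OF bounded_bilinear_matrix_mult]
  bounded_bilinear.zero_right[OF bounded_bilinear_matrix_mult]
  bounded_bilinear.scaleR_left[OF bounded_bilinear_matrix_mult]
  bounded_bilinear.scaleR_right[OF bounded_bilinear_matrix_mult]
  matrix_mul_assoc

lemmas transpose_simps =
  linear_add[OF bounded_linear.linear[OF bounded_linear_transpose]]
  linear_diff[OF bounded_linear.linear[OF bounded_linear_transpose]]
  linear_neg[OF bounded_linear.linear[OF bounded_linear_transpose]]
  linear_0[OF bounded_linear.linear[OF bounded_linear_transpose]]
  transpose_scalar matrix_transpose_mul transpose_transpose transpose_mat

text \<open>\<open>norm\<close> on matrices is the Euclidean norm of the entries, whereas the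
  hypothesis bounds the operator norm. Every entry is at most the operator norm, and summation over
  rows and columns costs only dimensional factors.\<close>

lemma norm_matrix_le_of_mult:
  fixes M :: "real ^ 'n ^ 'm"
  assumes "\<And>x. norm (M *v x) \<le> b * norm x"
  shows "norm M \<le> of_nat CARD('m) * (of_nat CARD('n) * b)"
proof -
  have "\<bar>M $ i $ j\<bar> \<le> b" for i j
    using matrix_component_le_onorm[of M i j] onorm_le[of "(*v) M" b, OF assms] by linarith
  then have row: "norm (M $ i) \<le> of_nat CARD('n) * b" for i
    by (intro order_trans[OF norm_le_l1_cart] sum_bounded_above)
  have "norm M \<le> (\<Sum>i\<in>UNIV. norm (M $ i))"
    unfolding norm_vec_def[of M] by (rule L2_set_le_sum) simp
  also have "\<dots> \<le> of_nat CARD('m) * (of_nat CARD('n) * b)"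
    by (rule sum_bounded_above) (rule row)
  finally show ?thesis .
qed

lemma norm_matrix_vector_mult_le:
  obtains c :: real where "0 < c"
    "\<And>(M :: real ^ 'n ^ 'm) x. norm (M *v x) \<le> c * norm M * norm x"
proof -
  have "bounded_bilinear ((*v) :: real ^ 'n ^ 'm \<Rightarrow> real ^ 'n \<Rightarrow> real ^ 'm)"
    unfolding bilinear_conv_bounded_bilinear[symmetric] bilinear_def
    by (auto intro!: linearI simp: matrix_vector_right_distrib matrix_vector_mult_add_rdistrib
        matrix_vector_mult_scaleR scaleR_matrix_vector_assoc)
  then show ?thesis
    using bounded_bilinear.pos_bounded that by (metis mult.assoc mult.commute)
qed

text \<open>The spectral norm of the final estimate is \<open>onorm\<close>; this bound carries
  estimates in \<open>norm\<close> over to it.\<close>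

lemma onorm_matrix_le_norm:
  obtains c :: real where "0 < c"
    "\<And>M :: real ^ 'n ^ 'm. onorm ((*v) M) \<le> c * norm M"
proof -
  obtain c :: real where c: "0 < c" "\<And>(M :: real ^ 'n ^ 'm) x. norm (M *v x) \<le> c * norm M * norm x"
    using norm_matrix_vector_mult_le by blast
  show ?thesis
    by (rule that[of c]) (use c in \<open>auto intro: onorm_le\<close>)
qed

lemma invertible_matrix_inv:
  assumes "invertible (A :: 'a::semiring_1 ^ 'n ^ 'n)"
  shows "A ** matrix_inv A = mat 1" "matrix_inv A ** A = mat 1"
  using someI_ex[OF assms[unfolded invertible_def]] unfolding matrix_inv_def by auto

text \<open>Coercivity rather than \<open>pd\<close> is the working notion, since it survives small
  perturbations and makes sense for the possibly non-symmetric matrices near the curve. It forces a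
  trivial kernel, which suffices for a square matrix.\<close>

lemma coercive_invertible:
  fixes S :: "real ^ 'm ^ 'm"
  assumes "0 < r" "\<And>x. r * (x \<bullet> x) \<le> x \<bullet> (S *v x)"
  shows "invertible S"
proof -
  have "S *v x = 0 \<Longrightarrow> x = 0" for x
    using assms(2)[of x] \<open>0 < r\<close> by (simp add: mult_le_0_iff) (metis inner_gt_zero_iff not_less)
  then show ?thesis
    by (metis invertible_def matrix_left_invertible_ker matrix_left_right_inverse)
qed

text \<open>For \<open>x = matrix_inv S *v y\<close>, coercivity and Cauchy-Schwarz give
  \<open>r * norm x \<le> norm y\<close>, so the inverse has operator norm at most
  \<open>1 / r\<close>.\<close>

lemma coercive_matrix_inv_bound:
  fixes S :: "real ^ 'm ^ 'm"
  assumes "0 < r" "\<And>x. r * (x \<bullet> x) \<le> x \<bullet> (S *v x)"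
  shows "norm (matrix_inv S) \<le> of_nat CARD('m) * (of_nat CARD('m) * (1 / r))"
proof (rule norm_matrix_le_of_mult)
  fix y
  define x where "x = matrix_inv S *v y"
  have "S *v x = y"
    using invertible_matrix_inv(1)[OF coercive_invertible[OF assms]]
    by (simp add: x_def matrix_vector_mul_assoc)
  then have "r * (norm x * norm x) \<le> norm x * norm y"
    using assms(2)[of x] Cauchy_Schwarz_ineq2[of x y]
    by (simp add: power2_norm_eq_inner[symmetric] power2_eq_square)
  then have "r * norm x \<le> norm y"
    by (cases "x = 0") (auto simp: mult.commute mult.left_commute)
  then show "norm (matrix_inv S *v y) \<le> 1 / r * norm y"
    using \<open>0 < r\<close> by (simp add: x_def field_simps)
qed

text \<open>The resolvent identity, which turns closeness of matrices into closeness of their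
  inverses.\<close>

lemma matrix_inv_diff:
  fixes S T :: "real ^ 'm ^ 'm"
  assumes "invertible S" "invertible T"
  shows "matrix_inv S - matrix_inv T = matrix_inv S ** (T - S) ** matrix_inv T"
proof -
  have "matrix_inv S ** (T - S) ** matrix_inv T =
      matrix_inv S ** (T ** matrix_inv T) - (matrix_inv S ** S) ** matrix_inv T"
    by (simp add: matrix_mult_simps)
  then show ?thesis by (simp add: invertible_matrix_inv assms)
qed

text \<open>Close to \<open>K\<close> half of the coercivity constant remains, so the inverses stay
  uniformly bounded and the resolvent identity passes the Lipschitz bound of \<open>S\<close> on to
  them.\<close>

lemma calm_on_matrix_inv:
  fixes S :: "'a::real_normed_vector \<Rightarrow> real ^ 'm ^ 'm"
  assumes S: "calm_on K S" and r: "0 < r"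
    and co: "\<And>u x. u \<in> K \<Longrightarrow> r * (x \<bullet> x) \<le> x \<bullet> (S u *v x)"
  shows "calm_on K (\<lambda>u. matrix_inv (S u))"
proof -
  obtain \<rho> L where L: "0 < \<rho>" "0 \<le> L" "\<And>u. u \<in> K \<Longrightarrow> norm (S u) \<le> L"
    "\<And>u v. u \<in> K \<Longrightarrow> norm (v - u) \<le> \<rho> \<Longrightarrow> norm (S v - S u) \<le> L * norm (v - u)"
    using calm_onE[OF S] by blast
  obtain c :: real where c: "0 < c"
    "\<And>(M :: real ^ 'm ^ 'm) x. norm (M *v x) \<le> c * norm M * norm x"
    using norm_matrix_vector_mult_le by blast
  obtain d where d: "0 < d" "\<And>(M :: real ^ 'm ^ 'm) (N :: real ^ 'm ^ 'm). norm (M ** N) \<le> norm M * norm N * d"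
    using bounded_bilinear.pos_bounded[OF bounded_bilinear_matrix_mult] by blast
  \<comment> \<open>The bound for inverses of matrices that are coercive with constant
    \<open>r / 2\<close>.\<close>
  define b where "b = of_nat CARD('m) * (of_nat CARD('m) * (1 / (r / 2)))"
  have b: "0 \<le> b" using r by (simp add: b_def)
  \<comment> \<open>Within this radius \<open>c * norm (S v - S u)\<close> is at most
    \<open>r / 2\<close>, so the quadratic form loses at most half of its coercivity. Taking
    \<open>L + 1\<close> in place of \<open>L\<close> avoids a zero denominator.\<close>
  define \<rho>' where "\<rho>' = min \<rho> (r / (2 * c * (L + 1)))"
  have \<rho>': "0 < \<rho>'" "\<rho>' \<le> \<rho>" "\<rho>' \<le> r / (2 * c * (L + 1))"
    using L r c by (auto simp: \<rho>'_def)
  have near: "r / 2 * (x \<bullet> x) \<le> x \<bullet> (S v *v x)" if u: "u \<in> K" and v: "norm (v - u) \<le> \<rho>'" for u v x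
  proof -
    have "c * norm (S v - S u) \<le> c * (L * \<rho>')"
      using L(4)[OF u, of v] v \<rho>' c mult_left_mono[OF v L(2)] by (intro mult_left_mono) auto
    also have "\<dots> \<le> c * ((L + 1) * (r / (2 * c * (L + 1))))"
      using L(2) \<rho>' c(1) by (intro mult_left_mono mult_mono) auto
    also have "\<dots> = r / 2"
      using c(1) L(2) by (simp add: add_nonneg_eq_0_iff)
    finally have *: "c * norm (S v - S u) \<le> r / 2" .
    have "\<bar>x \<bullet> ((S v - S u) *v x)\<bar> \<le> norm x * (c * norm (S v - S u) * norm x)"
      using Cauchy_Schwarz_ineq2 order_trans mult_left_mono[OF c(2) norm_ge_zero] by blast
    also have "\<dots> \<le> norm x * (r / 2 * norm x)"
      using * by (intro mult_left_mono mult_right_mono) auto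
    also have "\<dots> = r / 2 * (x \<bullet> x)"
      by (simp add: power2_norm_eq_inner[symmetric] power2_eq_square)
    finally have "\<bar>x \<bullet> (S v *v x) - x \<bullet> (S u *v x)\<bar> \<le> r / 2 * (x \<bullet> x)"
      by (simp add: matrix_vector_mult_diff_rdistrib inner_diff_right)
    then show ?thesis using co[OF u, of x] by argo
  qed
  have r2: "0 < r / 2" using r by simp
  show ?thesis
  proof (rule calm_onI[of \<rho>' "b + b * b * L * d * d"])
    fix u assume u: "u \<in> K"
    have nu: "r / 2 * (x \<bullet> x) \<le> x \<bullet> (S u *v x)" for x
      using near[OF u, of u x] \<rho>' by simp
    have bu: "norm (matrix_inv (S u)) \<le> b"
      using coercive_matrix_inv_bound[OF r2 nu] by (simp add: b_def)
    moreover have "0 \<le> b * b * L * d * d" using b L d by simp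
    ultimately show "norm (matrix_inv (S u)) \<le> b + b * b * L * d * d" by linarith
    fix v assume v: "norm (v - u) \<le> \<rho>'"
    have bv: "norm (matrix_inv (S v)) \<le> b"
      using coercive_matrix_inv_bound[OF r2 near[OF u v]] by (simp add: b_def)
    have "norm (matrix_inv (S v) - matrix_inv (S u))
        = norm (matrix_inv (S v) ** (S u - S v) ** matrix_inv (S u))"
      using matrix_inv_diff coercive_invertible[OF r2 near[OF u v]] coercive_invertible[OF r2 nu]
      by metis
    also have "\<dots> \<le> norm (matrix_inv (S v) ** (S u - S v)) * norm (matrix_inv (S u)) * d"
      by (rule d)
    also have "\<dots> \<le> norm (matrix_inv (S v)) * norm (S u - S v) * d * norm (matrix_inv (S u)) * d"
      using d by (intro mult_right_mono) auto
    also have "\<dots> \<le> b * (L * norm (v - u)) * d * b * d"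
      using L(4)[OF u, of v] v \<rho>' bu bv b L(2) d(1) norm_minus_commute[of "S u" "S v"]
      by (intro mult_right_mono mult_mono) auto
    also have "\<dots> \<le> (b + b * b * L * d * d) * norm (v - u)"
      using b by (simp add: algebra_simps)
    finally show "norm (matrix_inv (S v) - matrix_inv (S u)) \<le> (b + b * b * L * d * d) * norm (v - u)" .
  qed (use \<rho>' b L d in auto)
qed

section \<open>Convergence of one-step schemes with a calm right-hand side\<close>

lemma has_vector_derivative_bound:
  fixes f :: "real \<Rightarrow> 'a::real_normed_vector"
  assumes "\<And>t. t \<in> {a..b} \<Longrightarrow> (f has_vector_derivative f' t) (at t within {a..b})"
    and "\<And>t. t \<in> {a..b} \<Longrightarrow> norm (f' t) \<le> B"
    and "s \<in> {a..b}" "t \<in> {a..b}"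
  shows "norm (f s - f t) \<le> B * \<bar>s - t\<bar>"
proof -
  have "norm (f s - f t) \<le> B * norm (s - t)"
  proof (rule differentiable_bound[of "{a..b}" f "\<lambda>t h. h *\<^sub>R f' t"])
    fix t assume t: "t \<in> {a..b}"
    show "(f has_derivative (\<lambda>h. h *\<^sub>R f' t)) (at t within {a..b})"
      using assms(1)[OF t] by (simp add: has_vector_derivative_def)
    show "onorm (\<lambda>h. h *\<^sub>R f' t) \<le> B"
      using assms(2)[OF t] by (intro onorm_le) (simp add: mult.commute[of B] mult_left_mono)
  qed (use assms in auto)
  then show ?thesis by simp
qed

text \<open>\<open>F\<close> is controlled only near the exact curve, so on fine meshes the error
  bound and the fact that the scheme stays in the tube are obtained in one induction.\<close>

lemma one_step_convergence:
  fixes x :: "real \<Rightarrow> 'a::real_normed_vector" and F :: "real \<times> 'a \<Rightarrow> 'a"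
  assumes T: "0 < T"
    and x'_all: "\<forall>t\<in>{0..T}. (x has_vector_derivative - F (0, x t)) (at t within {0..T})"
    and F: "calm_on ((\<lambda>t. (0, x t)) ` {0..T}) F"
  shows "\<exists>K>0. \<forall>(N::nat) \<tau> z. 1 \<le> N \<longrightarrow> \<tau> = T / real N \<longrightarrow> z N = x T \<longrightarrow>
      (\<forall>k<N. z k = z (Suc k) + \<tau> *\<^sub>R F (\<tau>, z (Suc k))) \<longrightarrow>
      (\<forall>l\<le>N. norm (x (real l * \<tau>) - z l) \<le> K * \<tau>)"
proof -
  note x' = x'_all[rule_format]
  obtain \<rho> L where L: "0 < \<rho>" "0 \<le> L"
    and bd: "\<And>t. t \<in> {0..T} \<Longrightarrow> norm (F (0, x t)) \<le> L"
    and lip: "\<And>t v. t \<in> {0..T} \<Longrightarrow> norm (v - (0, x t)) \<le> \<rho> \<Longrightarrow>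
      norm (F v - F (0, x t)) \<le> L * norm (v - (0, x t))"
    using calm_onE[OF F] by (metis (no_types, lifting) image_eqI)
  \<comment> \<open>The solved error recursion has the factor \<open>(1 + L) * \<tau>\<close> times
    a power of \<open>1 + L * \<tau>\<close>, and that power is at most
    \<open>exp (L * T)\<close>.\<close>
  define K where "K = (1 + L) * exp (L * T)"
  have K: "0 < K" using L by (simp add: K_def)
  \<comment> \<open>small \<open>\<tau>\<close>: the scheme never leaves the tube of radius \<open>\<rho>\<close>\<close>
  have large: "norm (x (real l * \<tau>) - z l) \<le> K * \<tau>"
    if N: "1 \<le> N" and \<tau>: "\<tau> = T / real N" and zN: "z N = x T"
      and rec: "\<forall>k<N. z k = z (Suc k) + \<tau> *\<^sub>R F (\<tau>, z (Suc k))"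
      and small: "K * \<tau> \<le> \<rho>" and l: "l \<le> N" for N :: nat and \<tau> z l
  proof -
    have \<tau>0: "0 < \<tau>" using T N \<tau> by simp
    have N\<tau>: "real N * \<tau> = T" using N \<tau> by simp
    define e where "e k = norm (x (real k * \<tau>) - z k)" for k
    have power_le: "(1 + L * \<tau>) ^ j \<le> exp (L * T)" if "j \<le> N" for j
    proof -
      have "(1 + L * \<tau>) ^ j \<le> exp (L * \<tau>) ^ j"
        using L \<tau>0 by (intro power_mono exp_ge_add_one_self) auto
      also have "\<dots> = exp (L * (real j * \<tau>))"
        by (simp add: exp_of_nat_mult[symmetric] algebra_simps)
      also have "\<dots> \<le> exp (L * T)"
        using that L \<tau>0 N\<tau> by (simp add: mult_left_mono mult_right_mono flip: N\<tau>)
      finally show ?thesis .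
    qed
    \<comment> \<open>The induction runs backward from \<open>N\<close>, with \<open>j\<close> the
      number of steps taken. The right-hand side is the exact solution of the error recursion with
      zero terminal error, written without division by \<open>L\<close>.\<close>
    have "e (N - j) \<le> (1 + L) * \<tau> * ((1 + L * \<tau>) ^ j - 1)" if "j \<le> N" for j
      using that
    proof (induction j)
      case 0
      then show ?case by (simp add: e_def N\<tau> zN)
    next
      case (Suc j)
      define k where "k = N - Suc j"
      have k: "k < N" "N - j = Suc k" using Suc.prems by (auto simp: k_def)
      let ?a = "real k * \<tau>" and ?b = "real (Suc k) * \<tau>"
      \<comment> \<open>\<open>D\<close> bounds the distance from \<open>(\<tau>, z (Suc k))\<close>
        to \<open>(0, x s)\<close> for every \<open>s\<close> in the mesh interval:
        \<open>\<tau>\<close> from the first component, \<open>L * \<tau>\<close> from the motion of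
        \<open>x\<close>, and \<open>e (Suc k)\<close> from the error so far. Since \<open>D\<close>
        is at most \<open>K * \<tau>\<close>, the point lies in the tube.\<close>
      define D where "D = (1 + L) * \<tau> * (1 + L * \<tau>) ^ j"
      have IH: "(1 + L) * \<tau> + e (Suc k) \<le> D"
        using Suc k by (simp add: D_def algebra_simps)
      have D: "D \<le> \<rho>"
      proof -
        have "D \<le> (1 + L) * \<tau> * exp (L * T)"
          unfolding D_def using L \<tau>0 power_le[of j] Suc.prems by (intro mult_left_mono) auto
        also have "\<dots> = K * \<tau>" by (simp add: K_def)
        finally show ?thesis using small by linarith
      qed
      have b: "?b \<le> T"
        using k \<tau>0 N\<tau> by (metis Suc_leI mult_right_mono of_nat_mono less_imp_le)
      have sub: "{?a..?b} \<subseteq> {0..T}" using b \<tau>0 by auto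
      have bmem: "?b \<in> {0..T}" using b \<tau>0 by simp
      define c where "c = F (\<tau>, z (Suc k))"
      define h where "h s = x s + s *\<^sub>R c" for s
      have "norm (h ?b - h ?a) \<le> L * D * \<bar>?b - ?a\<bar>"
      proof (rule has_vector_derivative_bound[where f' = "\<lambda>s. - F (0, x s) + c"])
        fix s assume s: "s \<in> {?a..?b}"
        then have sT: "s \<in> {0..T}" using sub by blast
        show "(h has_vector_derivative - F (0, x s) + c) (at s within {?a..?b})"
          unfolding h_def
          by (intro has_vector_derivative_add
              has_vector_derivative_within_subset[OF x'[OF sT] sub])
             (auto intro!: derivative_eq_intros simp: has_vector_derivative_def)
        have "norm (x ?b - x s) \<le> L * \<bar>?b - s\<bar>"
          using has_vector_derivative_bound[OF x', of L ?b s] bd bmem sT by simp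
        also have "\<dots> \<le> L * \<tau>"
          using s L by (intro mult_left_mono) (auto simp: algebra_simps)
        finally have *: "norm (x ?b - x s) \<le> L * \<tau>" .
        have "norm (z (Suc k) - x s) \<le> e (Suc k) + norm (x ?b - x s)"
          using norm_triangle_ineq[of "z (Suc k) - x ?b" "x ?b - x s"]
          by (simp add: e_def norm_minus_commute)
        moreover have "norm ((\<tau>, z (Suc k)) - (0, x s)) \<le> \<tau> + norm (z (Suc k) - x s)"
          using norm_Pair_le[of \<tau> "z (Suc k) - x s"] \<tau>0 by simp
        ultimately have v: "norm ((\<tau>, z (Suc k)) - (0, x s)) \<le> D"
          using IH * by (simp add: algebra_simps)
        have "norm (c - F (0, x s)) \<le> L * norm ((\<tau>, z (Suc k)) - (0, x s))"
          unfolding c_def using lip[OF sT, of "(\<tau>, z (Suc k))"] v D by linarith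
        also have "\<dots> \<le> L * D" using v L by (intro mult_left_mono) auto
        finally show "norm (- F (0, x s) + c) \<le> L * D" by simp
      qed (use \<tau>0 in auto)
      also have "\<bar>?b - ?a\<bar> = \<tau>" using \<tau>0 by (simp add: algebra_simps)
      finally have inc: "norm (h ?b - h ?a) \<le> L * D * \<tau>" .
      have "x ?a - z k = (x ?b - z (Suc k)) - (h ?b - h ?a)"
        using rec k by (simp add: h_def c_def algebra_simps)
      then have "e k \<le> e (Suc k) + norm (h ?b - h ?a)"
        unfolding e_def by (metis norm_triangle_ineq4)
      also have "\<dots> \<le> D - (1 + L) * \<tau> + L * D * \<tau>" using IH inc by linarith
      also have "\<dots> = (1 + L) * \<tau> * ((1 + L * \<tau>) ^ Suc j - 1)"
        by (simp add: D_def algebra_simps)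
      finally show ?case by (simp add: k_def)
    qed
    from this[of "N - l"] l have "e l \<le> (1 + L) * \<tau> * ((1 + L * \<tau>) ^ (N - l) - 1)" by simp
    also have "\<dots> \<le> (1 + L) * \<tau> * exp (L * T)"
      using power_le[of "N - l"] L \<tau>0 by (intro mult_left_mono) auto
    also have "\<dots> = K * \<tau>" by (simp add: K_def)
    finally show ?thesis by (simp add: e_def)
  qed
  \<comment> \<open>for a fixed \<open>N\<close> there is at most one discrete solution, hence a finite error\<close>
  have fixed: "\<exists>b\<ge>0. \<forall>z. z N = x T \<longrightarrow>
      (\<forall>k<N. z k = z (Suc k) + (T / real N) *\<^sub>R F (T / real N, z (Suc k))) \<longrightarrow>
      (\<forall>l\<le>N. norm (x (real l * (T / real N)) - z l) \<le> b * (T / real N))"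
    (is "\<exists>b\<ge>0. \<forall>z. ?s z \<longrightarrow> ?r z \<longrightarrow> ?c b z")
    if N: "1 \<le> N" for N :: nat
  proof (cases "\<exists>z. ?s z \<and> ?r z")
    case True
    then obtain z0 where z0: "?s z0" "?r z0" by blast
    define m where "m = Max ((\<lambda>l. norm (x (real l * (T / real N)) - z0 l)) ` {..N})"
    have m: "norm (x (real l * (T / real N)) - z0 l) \<le> m" if "l \<le> N" for l
      unfolding m_def using that by (intro Max_ge) auto
    have m0: "0 \<le> m" using m[of 0] norm_ge_zero order_trans by blast
    have "z l = z0 l" if z: "?s z" "?r z" and "l \<le> N" for z l
      using \<open>l \<le> N\<close>
    proof (induction rule: inc_induct)
      case base
      then show ?case using z z0 by simp
    next
      case (step n)
      then show ?case using z z0 by simp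
    qed
    \<comment> \<open>The largest error on this mesh is divided by the mesh size to fit the form of
      the estimate.\<close>
    then have "?c (m / (T / real N)) z" if "?s z" "?r z" for z
      using m that T N by simp
    moreover have "0 \<le> m / (T / real N)" using m0 T by simp
    ultimately show ?thesis by blast
  qed blast
  then obtain b where b: "\<And>N. 1 \<le> N \<Longrightarrow> 0 \<le> b N"
    "\<And>N z l. 1 \<le> N \<Longrightarrow> z N = x T \<Longrightarrow>
      (\<forall>k<N. z k = z (Suc k) + (T / real N) *\<^sub>R F (T / real N, z (Suc k))) \<Longrightarrow>
      l \<le> N \<Longrightarrow> norm (x (real l * (T / real N)) - z l) \<le> b N * (T / real N)"
    by metis
  \<comment> \<open>From \<open>N0\<close> on the mesh satisfies
    \<open>K * \<tau> \<le> \<rho>\<close>, so the tube argument applies.\<close>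
  obtain N0 where N0: "K * T / \<rho> \<le> real N0" using real_arch_simple by blast
  \<comment> \<open>The sum dominates each constant of the coarse meshes because all of them are
    nonnegative.\<close>
  define M where "M = K + (\<Sum>N = 1..N0. b N)"
  have sum0: "0 \<le> (\<Sum>N = 1..N0. b N)" using b(1) by (intro sum_nonneg) auto
  show ?thesis
  proof (intro exI[of _ M] conjI allI impI)
    show "0 < M" using K sum0 by (simp add: M_def)
    fix N :: nat and \<tau> z l
    assume N: "1 \<le> N" and \<tau>: "\<tau> = T / real N" and z: "z N = x T"
      "\<forall>k<N. z k = z (Suc k) + \<tau> *\<^sub>R F (\<tau>, z (Suc k))" and l: "l \<le> N"
    have \<tau>0: "0 < \<tau>" using T N \<tau> by simp
    show "norm (x (real l * \<tau>) - z l) \<le> M * \<tau>"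
    proof (cases "N0 \<le> N")
      case True
      then have "K * T / \<rho> \<le> real N" using N0 by simp
      then have "K * \<tau> \<le> \<rho>" using N L T by (simp add: \<tau> field_simps)
      then have "norm (x (real l * \<tau>) - z l) \<le> K * \<tau>" using large N \<tau> z l by blast
      also have "\<dots> \<le> M * \<tau>" using sum0 \<tau>0 by (intro mult_right_mono) (auto simp: M_def)
      finally show ?thesis .
    next
      case False
      then have "b N \<le> (\<Sum>N = 1..N0. b N)" using N b(1) by (intro member_le_sum) auto
      then have "b N \<le> M" using K by (simp add: M_def)
      then have "b N * \<tau> \<le> M * \<tau>" using \<tau>0 by (intro mult_right_mono) auto
      moreover have "norm (x (real l * \<tau>) - z l) \<le> b N * \<tau>"
        using b(2)[of N z l] N z l unfolding \<tau> by blast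
      ultimately show ?thesis by linarith
    qed
  qed
qed

section \<open>Backward uniqueness, and coercivity uniform along the curve\<close>

text \<open>A Gronwall argument: the weight \<open>exp (2 * L * s)\<close> makes the squared norm
  nondecreasing, so its value at \<open>t\<close> is at most its value at \<open>T\<close>, which is
  zero.\<close>

lemma linear_growth_zero:
  fixes x :: "real \<Rightarrow> 'a::real_inner"
  assumes x': "\<And>t. t \<in> {0..T} \<Longrightarrow> (x has_vector_derivative g t) (at t within {0..T})"
    and g: "\<And>t. t \<in> {0..T} \<Longrightarrow> norm (g t) \<le> L * norm (x t)"
    and T: "x T = 0" and t: "t \<in> {0..T}"
  shows "x t = 0"
proof -
  let ?w = "\<lambda>s. exp (2 * L * s) * (x s \<bullet> x s)"
  let ?w' = "\<lambda>s h. h * (exp (2 * L * s) * (2 * (L * (x s \<bullet> x s)) + 2 * (x s \<bullet> g s)))"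
  have "\<exists>s\<in>{t..T}. ?w T - ?w t = ?w' s (T - t)"
  proof (rule mvt_very_simple)
    fix s assume "t \<le> s" "s \<le> T"
    then have s: "s \<in> {0..T}" "{t..T} \<subseteq> {0..T}" using t by auto
    have "(x has_derivative (\<lambda>h. h *\<^sub>R g s)) (at s within {t..T})"
      using has_vector_derivative_within_subset[OF x'[OF s(1)] s(2)]
      by (simp add: has_vector_derivative_def)
    then show "(?w has_derivative ?w' s) (at s within {t..T})"
      by (auto intro!: derivative_eq_intros simp: algebra_simps inner_commute)
  qed (use t in auto)
  then obtain s where s: "s \<in> {t..T}" "?w T - ?w t = ?w' s (T - t)" by blast
  have sT: "s \<in> {0..T}" using s t by auto
  have "\<bar>x s \<bullet> g s\<bar> \<le> norm (x s) * (L * norm (x s))"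
    using Cauchy_Schwarz_ineq2 order_trans mult_left_mono[OF g[OF sT] norm_ge_zero] by blast
  also have "\<dots> = L * (x s \<bullet> x s)"
    by (simp add: power2_norm_eq_inner[symmetric] power2_eq_square)
  finally have "0 \<le> ?w' s (T - t)"
    using s by (intro mult_nonneg_nonneg) auto
  with s T have "?w t \<le> 0" by simp
  then show ?thesis by (simp add: mult_le_0_iff) (metis inner_gt_zero_iff not_less)
qed

text \<open>The quadratic form attains a positive minimum on the compact unit sphere, and
  homogeneity extends the bound to all vectors.\<close>

lemma pd_coercive:
  assumes "pd (R :: real ^ 'm ^ 'm)"
  obtains r where "0 < r" "\<And>x. r * (x \<bullet> x) \<le> x \<bullet> (R *v x)"
proof -
  have cont: "continuous_on (sphere 0 1) (\<lambda>x. x \<bullet> (R *v x))"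
    by (intro continuous_intros linear_continuous_on matrix_vector_mul_bounded_linear)
  have "sphere (0 :: real ^ 'm) 1 \<noteq> {}" by simp
  from continuous_attains_inf[OF compact_sphere this cont]
  obtain y where y: "y \<in> sphere 0 1"
    "\<And>x. x \<in> sphere 0 1 \<Longrightarrow> y \<bullet> (R *v y) \<le> x \<bullet> (R *v x)"
    by auto
  have "y \<bullet> (R *v y) * (x \<bullet> x) \<le> x \<bullet> (R *v x)" for x
  proof (cases "x = 0")
    case False
    have "y \<bullet> (R *v y) \<le> (x /\<^sub>R norm x) \<bullet> (R *v (x /\<^sub>R norm x))"
      using False by (intro y(2)) auto
    also have "\<dots> = x \<bullet> (R *v x) / (x \<bullet> x)"
      by (simp add: matrix_vector_mult_scaleR power2_norm_eq_inner[symmetric] power2_eq_square field_simps)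
    finally show ?thesis using False by (simp add: field_simps)
  qed simp
  moreover have "y \<noteq> 0" using y by auto
  ultimately show ?thesis using that assms unfolding pd_def by blast
qed

text \<open>The added form is that of \<open>P\<close> at \<open>D *v x\<close>, hence nonnegative.
  One constant for \<open>R\<close> thus serves for all times along the curve.\<close>

lemma coercive_add_congruence:
  fixes D :: "real ^ 'm ^ 'n"
  assumes "\<And>x. r * (x \<bullet> x) \<le> x \<bullet> (R *v x)" "psd P"
  shows "r * (x \<bullet> x) \<le> x \<bullet> ((R + transpose D ** P ** D) *v x)"
proof -
  have "x \<bullet> ((transpose D ** P ** D) *v x) = (D *v x) \<bullet> (P *v (D *v x))"
    by (simp only: matrix_vector_mul_assoc[symmetric] dot_lmul_matrix[symmetric] vector_transpose_matrix)
  moreover have "0 \<le> (D *v x) \<bullet> (P *v (D *v x))"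
    using assms(2) by (simp add: psd_def)
  ultimately show ?thesis
    using assms(1)[of x] by (simp add: matrix_vector_mult_add_rdistrib inner_add_right)
qed

lemma transpose_matrix_inv:
  fixes S :: "real ^ 'm ^ 'm"
  assumes "invertible S" "transpose S = S"
  shows "transpose (matrix_inv S) = matrix_inv S"
proof -
  have "transpose (matrix_inv S) ** S = mat 1"
    using arg_cong[OF invertible_matrix_inv(1)[OF assms(1)], of transpose] assms(2)
    by (simp add: transpose_simps)
  then show ?thesis
    by (metis assms(1) invertible_matrix_inv(1) matrix_mul_assoc matrix_mul_lid matrix_mul_rid)
qed

section \<open>A common right-hand side for both Riccati equations, and symmetry of the second
  solution\<close>

text \<open>This is the increment of one difference step divided by \<open>\<tau>\<close>, with the
  division carried out: it remains meaningful at \<open>\<tau> = 0\<close>, where it gives the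
  differential equation. \<open>W\<close> and \<open>L\<close> are parameters so that both equations
  are instances.\<close>

definition riccati_rhs ::
  "real \<Rightarrow> real ^ 'n ^ 'n \<Rightarrow> real ^ 'm ^ 'n \<Rightarrow> real ^ 'n ^ 'n \<Rightarrow> real ^ 'm ^ 'm \<Rightarrow>
   real ^ 'n ^ 'm \<Rightarrow> real ^ 'n ^ 'n \<Rightarrow> real ^ 'n ^ 'n" where
  "riccati_rhs \<tau> A B Q W L Y =
    (let H = transpose B ** Y ** (mat 1 + \<tau> *\<^sub>R A) + L
     in Q + Y ** A + transpose A ** Y + \<tau> *\<^sub>R (transpose A ** Y ** A)
        - transpose H ** matrix_inv (W + \<tau> *\<^sub>R (transpose B ** Y ** B)) ** H)"

lemma riccati_rhs_step:
  "Y + \<tau> *\<^sub>R riccati_rhs \<tau> A B Q W L Y =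
    (let E = mat 1 + \<tau> *\<^sub>R A; H = transpose B ** Y ** E + L
     in transpose E ** Y ** E + \<tau> *\<^sub>R Q
        - \<tau> *\<^sub>R (transpose H ** matrix_inv (W + \<tau> *\<^sub>R (transpose B ** Y ** B)) ** H))"
  unfolding riccati_rhs_def Let_def
  by (simp only: scaleR_diff_right scaleR_add_right)
     (simp add: matrix_mult_simps transpose_simps scaleR_add_right)

text \<open>As \<open>\<tau>\<close> vanishes on \<open>K\<close>, the inverted matrix reduces there
  to \<open>W\<close>, whose coercivity is assumed. Positive step sizes are reached as nearby
  points.\<close>

lemma calm_on_riccati_rhs:
  assumes calm: "calm_on K \<tau>" "calm_on K A" "calm_on K Q" "calm_on K W" "calm_on K L" "calm_on K Y"
    and r: "0 < r" "\<And>u x. u \<in> K \<Longrightarrow> r * (x \<bullet> x) \<le> x \<bullet> (W u *v x)"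
    and \<tau>: "\<And>u. u \<in> K \<Longrightarrow> \<tau> u = 0"
  shows "calm_on K (\<lambda>u. riccati_rhs (\<tau> u) (A u) B (Q u) (W u) (L u) (Y u))"
  unfolding riccati_rhs_def Let_def
  using r \<tau>
  by (intro calm_on_add calm_on_diff calm_on_bilinear[OF bounded_bilinear_matrix_mult]
      calm_on_bilinear[OF bounded_bilinear_scaleR] calm_on_linear[OF bounded_linear_transpose]
      calm_on_matrix_inv[of _ _ r] calm_on_const calm) auto

definition P_rhs where
  "P_rhs A B C D Q R \<tau> X =
    riccati_rhs \<tau> A B (Q + transpose C ** X ** C) (R + transpose D ** X ** D) (transpose D ** X ** C) X"

text \<open>
  As in the difference equation, the matrix \<open>Z\<close> taken from \<open>P\<close> is evaluated at the new mesh point,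
  whereas \<open>Y\<close> is evaluated at the old one.
\<close>

definition Pi_rhs where
  "Pi_rhs A B C D Q R \<tau> Z Y =
    (let V = matrix_inv (R + transpose D ** Z ** D)
     in riccati_rhs \<tau> (A - B ** V ** transpose D ** Z ** C) B
          (Q + transpose C ** Z ** C - transpose C ** Z ** D ** V ** transpose D ** Z ** C)
          (R + transpose D ** Z ** D) 0 Y)"

lemmas calm_on_matrix_intros =
  calm_on_add calm_on_diff calm_on_bilinear[OF bounded_bilinear_matrix_mult]
  calm_on_linear[OF bounded_linear_transpose] calm_on_const

lemma calm_on_P_rhs:
  assumes calm: "calm_on K \<tau>" "calm_on K X"
    and r: "0 < r" "\<And>x. r * (x \<bullet> x) \<le> x \<bullet> (R *v x)"
    and K: "\<And>u. u \<in> K \<Longrightarrow> \<tau> u = 0" "\<And>u. u \<in> K \<Longrightarrow> psd (X u)"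
  shows "calm_on K (\<lambda>u. P_rhs A B C D Q R (\<tau> u) (X u))"
  unfolding P_rhs_def
  by (rule calm_on_riccati_rhs[where r = r])
     (intro calm_on_matrix_intros calm K r coercive_add_congruence; assumption)+

lemma calm_on_Pi_rhs:
  assumes calm: "calm_on K \<tau>" "calm_on K Z" "calm_on K Y"
    and r: "0 < r" "\<And>x. r * (x \<bullet> x) \<le> x \<bullet> (R *v x)"
    and K: "\<And>u. u \<in> K \<Longrightarrow> \<tau> u = 0" "\<And>u. u \<in> K \<Longrightarrow> psd (Z u)"
  shows "calm_on K (\<lambda>u. Pi_rhs A B C D Q R (\<tau> u) (Z u) (Y u))"
proof -
  have co: "r * (x \<bullet> x) \<le> x \<bullet> ((R + transpose D ** Z u ** D) *v x)" if "u \<in> K" for u x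
    by (rule coercive_add_congruence) (use r K that in auto)
  have W: "calm_on K (\<lambda>u. R + transpose D ** Z u ** D)"
    by (intro calm_on_matrix_intros calm)
  have V: "calm_on K (\<lambda>u. matrix_inv (R + transpose D ** Z u ** D))"
    by (rule calm_on_matrix_inv[OF W r(1) co])
  show ?thesis
    unfolding Pi_rhs_def Let_def
    by (rule calm_on_riccati_rhs[where r = r])
       (intro calm_on_matrix_intros calm V r K co; assumption)+
qed

text \<open>The shifts of \<open>A\<close> and \<open>Q\<close> by terms in \<open>V\<close> supply
  the cross terms and the remaining square in the expansion of the quadratic term in
  \<open>H\<close>. Symmetry of \<open>Z\<close>, \<open>Y\<close> and \<open>V\<close> matches
  these terms with their transposes.\<close>

lemma Pi_rhs_0:
  fixes D :: "real ^ 'm ^ 'n"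
  assumes "transpose Z = Z" "transpose Y = Y"
    and "transpose R = R" "invertible (R + transpose D ** Z ** D)"
  shows "Pi_rhs A B C D Q R 0 Z Y =
    (let H = transpose B ** Y + transpose D ** Z ** C
     in Y ** A + transpose A ** Y + transpose C ** Z ** C + Q
        - transpose H ** matrix_inv (R + transpose D ** Z ** D) ** H)"
proof -
  define V where "V = matrix_inv (R + transpose D ** Z ** D)"
  have V: "transpose V = V"
    unfolding V_def using assms
    by (intro transpose_matrix_inv) (simp_all add: transpose_simps matrix_mul_assoc)
  show ?thesis
    unfolding Pi_rhs_def riccati_rhs_def Let_def V_def[symmetric]
    by (simp add: V_def[symmetric] matrix_mult_simps transpose_simps assms V algebra_simps)
qed

text \<open>
  Symmetry is not part of the definition of a solution. The quadratic term is symmetric even when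
  \<open>Y t\<close> is not, so \<open>Y t - transpose (Y t)\<close> solves a linear equation.
\<close>

lemma riccati_Pi_symmetric:
  fixes D :: "real ^ 'm ^ 'n"
  assumes P: "\<And>t. t \<in> {0..T} \<Longrightarrow> psd (P t)"
    and sym: "transpose Q = Q" "transpose G = G" "pd R"
    and Pi: "riccati_Pi T A B C D Q R G P Y"
    and t: "t \<in> {0..T}"
  shows "transpose (Y t) = Y t"
proof -
  obtain r where r: "0 < r" "\<And>x. r * (x \<bullet> x) \<le> x \<bullet> (R *v x)"
    using pd_coercive[OF sym(3)] by blast
  have R: "transpose R = R" using sym by (simp add: pd_def)
  obtain d where d: "0 < d" "\<And>(M :: real ^ 'n ^ 'n) (N :: real ^ 'n ^ 'n). norm (M ** N) \<le> norm M * norm N * d"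
    using bounded_bilinear.pos_bounded[OF bounded_bilinear_matrix_mult] by blast
  define X where "X s = Y s - transpose (Y s)" for s
  define g where "g s = - (X s ** A) - transpose A ** X s" for s
  have "X t = 0"
  proof (rule linear_growth_zero[where g = g and T = T and t = t])
    fix s assume s: "s \<in> {0..T}"
    define V where "V = matrix_inv (R + transpose D ** P s ** D)"
    have Ps: "transpose (P s) = P s" using P[OF s] by (simp add: psd_def)
    have V: "transpose V = V"
      unfolding V_def using Ps R coercive_invertible[OF r(1) coercive_add_congruence[OF r(2) P[OF s]]]
      by (intro transpose_matrix_inv) (simp_all add: transpose_simps matrix_mul_assoc)
    define H where "H = transpose B ** Y s + transpose D ** P s ** C"
    obtain Y' where Y': "(Y has_vector_derivative Y') (at s within {0..T})"
      "Y' + Y s ** A + transpose A ** Y s + transpose C ** P s ** C + Q - transpose H ** V ** H = 0"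
      using Pi s unfolding riccati_Pi_def Let_def V_def H_def by blast
    have Y'_eq: "Y' = transpose H ** V ** H - Y s ** A - transpose A ** Y s - transpose C ** P s ** C - Q"
      using Y'(2) by (simp add: algebra_simps)
    \<comment> \<open>The quadratic term, the \<open>C\<close> term and \<open>Q\<close> are
      symmetric and cancel, which leaves the terms linear in \<open>X s\<close>.\<close>
    have "Y' - transpose Y' = g s"
      unfolding Y'_eq g_def X_def
      by (simp add: matrix_mult_simps transpose_simps V sym Ps algebra_simps)
    moreover have "(X has_vector_derivative Y' - transpose Y') (at s within {0..T})"
      unfolding X_def
      by (intro has_vector_derivative_diff Y'
          bounded_linear.has_vector_derivative[OF bounded_linear_transpose])
    ultimately show "(X has_vector_derivative g s) (at s within {0..T})" by simp
    have "norm (g s) \<le> norm (X s ** A) + norm (transpose A ** X s)"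
      unfolding g_def by (metis norm_minus_cancel norm_triangle_ineq4)
    also have "\<dots> \<le> norm (X s) * norm A * d + norm (transpose A) * norm (X s) * d"
      by (intro add_mono d)
    also have "\<dots> = (norm A * d + norm (transpose A) * d) * norm (X s)"
      by (simp add: algebra_simps)
    finally show "norm (g s) \<le> (norm A * d + norm (transpose A) * d) * norm (X s)" .
  qed (use Pi t sym in \<open>auto simp: X_def riccati_Pi_def\<close>)
  then show ?thesis by (simp add: X_def)
qed

section \<open>Convergence of the coupled scheme for both Riccati equations\<close>

theorem lemma3p7:
  fixes T :: real
    and A Ab C Cb Q Qb G Gb :: "real ^ 'n ^ 'n"
    and B Bb D Db :: "real ^ 'm ^ 'n"
    and R Rb :: "real ^ 'm ^ 'm"
    and P \<Pi>\<^sub>c :: "real \<Rightarrow> real ^ 'n ^ 'n"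
  assumes "0 < T"
    and "transpose Q = Q" "transpose Qb = Qb" "transpose G = G" "transpose Gb = Gb"
    and "transpose R = R" "transpose Rb = Rb"
    and "psd Q" "psd (Q + Qb)" "psd G" "psd (G + Gb)" "pd R" "pd (R + Rb)"
    and "riccati_P T A B C D Q R G P"
    and "riccati_Pi T (A + Ab) (B + Bb) (C + Cb) (D + Db) (Q + Qb) (R + Rb) (G + Gb) P \<Pi>\<^sub>c"
  shows "\<exists>K>0. \<forall>(N::nat) \<tau> p \<pi>.
           1 \<le> N \<longrightarrow> \<tau> = T / real N \<longrightarrow> \<tau> \<le> 1 \<longrightarrow>
           difference_riccati_P \<tau> N A B C D Q R G p \<longrightarrow>
           difference_riccati_Pi \<tau> N (A + Ab) (B + Bb) (C + Cb) (D + Db)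
             (Q + Qb) (R + Rb) (G + Gb) p \<pi> \<longrightarrow>
           (MAX l\<in>{0..N}. onorm ((*v) (\<Pi>\<^sub>c (real l * \<tau>) - \<pi> l))) \<le> K * \<tau>"
proof -
  note P = \<open>riccati_P T A B C D Q R G P\<close>
  note Pi = \<open>riccati_Pi T (A + Ab) (B + Bb) (C + Cb) (D + Db) (Q + Qb) (R + Rb) (G + Gb) P \<Pi>\<^sub>c\<close>
  define p_rhs where "p_rhs = P_rhs A B C D Q R"
  define \<pi>_rhs where "\<pi>_rhs = Pi_rhs (A + Ab) (B + Bb) (C + Cb) (D + Db) (Q + Qb) (R + Rb)"
  \<comment> \<open>Inserting the step for \<open>P\<close> into the one for \<open>\<Pi>\<close>
    makes the coupled scheme explicit in its values at \<open>Suc k\<close>. At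
    \<open>\<tau> = 0\<close> the inserted term vanishes.\<close>
  define F where "F u = (case u of (\<tau>, X, Y) \<Rightarrow>
    (p_rhs \<tau> X, \<pi>_rhs \<tau> (X + \<tau> *\<^sub>R p_rhs \<tau> X) Y))" for u
  define x where "x t = (P t, \<Pi>\<^sub>c t)" for t
  \<comment> \<open>The step size is a coordinate of the points, so calmness on this set includes
    Lipschitz dependence on \<open>\<tau>\<close>.\<close>
  let ?K = "(\<lambda>t. (0::real, x t)) ` {0..T}"
  obtain r where r: "0 < r" "\<And>x. r * (x \<bullet> x) \<le> x \<bullet> (R *v x)"
    using pd_coercive[OF \<open>pd R\<close>] by blast
  obtain rh where rh: "0 < rh" "\<And>x. rh * (x \<bullet> x) \<le> x \<bullet> ((R + Rb) *v x)"
    using pd_coercive[OF \<open>pd (R + Rb)\<close>] by blast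
  have psd: "psd (P t)" if "t \<in> {0..T}" for t
    using P that unfolding riccati_P_def by blast
  have x': "\<forall>t\<in>{0..T}. (x has_vector_derivative - F (0, x t)) (at t within {0..T})"
  proof
    fix t assume t: "t \<in> {0..T}"
    have symP: "transpose (P t) = P t" using psd[OF t] by (simp add: psd_def)
    have symPi: "transpose (\<Pi>\<^sub>c t) = \<Pi>\<^sub>c t"
      by (rule riccati_Pi_symmetric[OF psd _ _ \<open>pd (R + Rb)\<close> Pi t])
         (simp_all add: transpose_simps assms)
    have inv: "invertible (R + Rb + transpose (D + Db) ** P t ** (D + Db))"
      by (rule coercive_invertible[OF rh(1) coercive_add_congruence[OF rh(2) psd[OF t]]])
    have symR: "transpose (R + Rb) = R + Rb" by (simp add: transpose_simps assms)
    obtain P' where P': "(P has_vector_derivative P') (at t within {0..T})"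
      and P'_eq: "let H = transpose B ** P t + transpose D ** P t ** C;
             S = R + transpose D ** P t ** D
         in P' + P t ** A + transpose A ** P t + transpose C ** P t ** C + Q
            - transpose H ** matrix_inv S ** H = 0"
      using P t unfolding riccati_P_def by blast
    obtain Y' where Y': "(\<Pi>\<^sub>c has_vector_derivative Y') (at t within {0..T})"
      and Y'_eq: "let H = transpose (B + Bb) ** \<Pi>\<^sub>c t + transpose (D + Db) ** P t ** (C + Cb);
             S = R + Rb + transpose (D + Db) ** P t ** (D + Db)
         in Y' + \<Pi>\<^sub>c t ** (A + Ab) + transpose (A + Ab) ** \<Pi>\<^sub>c t
            + transpose (C + Cb) ** P t ** (C + Cb) + (Q + Qb)
            - transpose H ** matrix_inv S ** H = 0"
      using Pi t unfolding riccati_Pi_def by blast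
    have "P' + p_rhs 0 (P t) = 0"
      using P'_eq unfolding p_rhs_def P_rhs_def riccati_rhs_def Let_def
      by (simp add: add_ac diff_add_eq add_diff_eq)
    moreover have "Y' + \<pi>_rhs 0 (P t) (\<Pi>\<^sub>c t) = 0"
      using Y'_eq unfolding \<pi>_rhs_def Pi_rhs_0[OF symP symPi symR inv] Let_def
      by (simp only: add_ac diff_add_eq add_diff_eq)
    ultimately have "- F (0, x t) = (P', Y')"
      by (simp add: F_def x_def add_eq_0_iff)
    then show "(x has_vector_derivative - F (0, x t)) (at t within {0..T})"
      unfolding x_def using has_vector_derivative_Pair[OF P' Y'] by simp
  qed
  have "continuous_on {0..T} x"
    using x' by (meson continuous_on_vector_derivative)
  then have "bounded ?K"
    by (intro compact_imp_bounded compact_continuous_image continuous_intros) auto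
  then have id: "calm_on ?K (\<lambda>u. u)" by (rule calm_on_ident)
  have \<tau>: "calm_on ?K fst"
    by (rule calm_on_linear[OF bounded_linear_fst id])
  have X: "calm_on ?K (\<lambda>u. fst (snd u))" and Y: "calm_on ?K (\<lambda>u. snd (snd u))"
    by (intro calm_on_linear[OF bounded_linear_fst] calm_on_linear[OF bounded_linear_snd] id)+
  have p: "calm_on ?K (\<lambda>u. p_rhs (fst u) (fst (snd u)))"
    unfolding p_rhs_def by (rule calm_on_P_rhs[OF \<tau> X r]) (auto simp: x_def psd)
  have Z: "calm_on ?K (\<lambda>u. fst (snd u) + fst u *\<^sub>R p_rhs (fst u) (fst (snd u)))"
    by (intro calm_on_add calm_on_bilinear[OF bounded_bilinear_scaleR] \<tau> X p)
  \<comment> \<open>On \<open>?K\<close> the step size is zero and the inserted argument equals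
    \<open>P t\<close>. Positivity is therefore used only for the exact solution, never for the
    discrete \<open>p\<close>.\<close>
  have "calm_on ?K (\<lambda>u. \<pi>_rhs (fst u) (fst (snd u) + fst u *\<^sub>R p_rhs (fst u) (fst (snd u))) (snd (snd u)))"
    unfolding \<pi>_rhs_def by (rule calm_on_Pi_rhs[OF \<tau> Z Y rh]) (auto simp: x_def psd)
  from calm_on_Pair[OF p this] have "calm_on ?K F"
    unfolding F_def by (simp add: case_prod_unfold)
  from one_step_convergence[OF \<open>0 < T\<close> x' this] obtain K where K: "0 < K"
    "\<forall>(N::nat) \<tau> z. 1 \<le> N \<longrightarrow> \<tau> = T / real N \<longrightarrow> z N = x T \<longrightarrow>
      (\<forall>k<N. z k = z (Suc k) + \<tau> *\<^sub>R F (\<tau>, z (Suc k))) \<longrightarrow>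
      (\<forall>l\<le>N. norm (x (real l * \<tau>) - z l) \<le> K * \<tau>)"
    by (elim exE conjE)
  obtain c :: real where c: "0 < c" "\<And>M :: real ^ 'n ^ 'n. onorm ((*v) M) \<le> c * norm M"
    using onorm_matrix_le_norm by blast
  show ?thesis
  \<comment> \<open>The factor \<open>c\<close> accounts for the passage from the Euclidean matrix
    norm to the spectral norm.\<close>
  proof (intro exI[of _ "c * K"] conjI allI impI)
    fix N :: nat and \<tau> p \<pi>
    assume N: "1 \<le> N" "\<tau> = T / real N"
      and p: "difference_riccati_P \<tau> N A B C D Q R G p"
      and \<pi>: "difference_riccati_Pi \<tau> N (A + Ab) (B + Bb) (C + Cb) (D + Db)
             (Q + Qb) (R + Rb) (G + Gb) p \<pi>"
    define z where "z k = (p k, \<pi> k)" for k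
    have "z N = x T"
      using P Pi p \<pi> by (simp add: z_def x_def riccati_P_def riccati_Pi_def
          difference_riccati_P_def difference_riccati_Pi_def)
    moreover have "z k = z (Suc k) + \<tau> *\<^sub>R F (\<tau>, z (Suc k))" if "k < N" for k
    proof -
      have "p k = p (Suc k) + \<tau> *\<^sub>R p_rhs \<tau> (p (Suc k))"
        using p that unfolding difference_riccati_P_def p_rhs_def P_rhs_def riccati_rhs_step Let_def
        by (simp add: algebra_simps)
      \<comment> \<open>The recursion for \<open>\<pi> k\<close> contains \<open>p k\<close> itself,
        which the preceding fact rewrites in terms of \<open>p (Suc k)\<close>.\<close>
      moreover from this have "\<pi> k = \<pi> (Suc k) +
          \<tau> *\<^sub>R \<pi>_rhs \<tau> (p (Suc k) + \<tau> *\<^sub>R p_rhs \<tau> (p (Suc k))) (\<pi> (Suc k))"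
        using \<pi> that unfolding difference_riccati_Pi_def \<pi>_rhs_def Pi_rhs_def riccati_rhs_step Let_def
        by simp
      ultimately show ?thesis by (simp add: z_def F_def)
    qed
    ultimately have err: "norm (x (real l * \<tau>) - z l) \<le> K * \<tau>" if "l \<le> N" for l
      using K(2)[rule_format, OF N, of z l] that by blast
    have "onorm ((*v) (\<Pi>\<^sub>c (real l * \<tau>) - \<pi> l)) \<le> c * K * \<tau>" if "l \<le> N" for l
    proof -
      have "norm (\<Pi>\<^sub>c (real l * \<tau>) - \<pi> l) \<le> norm (x (real l * \<tau>) - z l)"
        using norm_snd_le[of "\<Pi>\<^sub>c (real l * \<tau>) - \<pi> l" "P (real l * \<tau>) - p l"]
        by (simp add: x_def z_def)
      also have "\<dots> \<le> K * \<tau>" by (rule err[OF that])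
      finally have "c * norm (\<Pi>\<^sub>c (real l * \<tau>) - \<pi> l) \<le> c * (K * \<tau>)"
        using c(1) by (intro mult_left_mono) auto
      then show ?thesis
        using c(2)[of "\<Pi>\<^sub>c (real l * \<tau>) - \<pi> l"] by (simp add: mult.assoc)
    qed
    then show "(MAX l\<in>{0..N}. onorm ((*v) (\<Pi>\<^sub>c (real l * \<tau>) - \<pi> l))) \<le> c * K * \<tau>"
      by (intro Max.boundedI) auto
  qed (use c K in simp)
qed

end
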